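(* Let $E_f$ be the graph with $E_f^0=\{v_k:k\ge1\}$, $E_f^1=\{e_k:k\ge1\}$, $s(e_1)=r(e_1)=r(e_2)=v_1$, and $s(e_k)=v_k=r(e_{k+1})$ for all $k\ge2$. Let $(X,\sigma)$ be the Deaconu-Renault system associated with $E_f$. Then $(X,\sigma)$ has the finite shadowing property but does not have the (infinite) shadowing property.
   Context: $\mathbb N=\{1,2,\ldots\}$. Graphs. A graph is $E=(E^0,E^1,r,s)$ with $E^0,E^1$ countable and $r,s:E^1\to E^0$. A finite path is a vertex (length $0$) or a sequence of edges $\alpha=\alpha_1\ldots\alpha_k$ with $r(\alpha_i)=s(\alpha_{i+1})$ for $1\le i<k$ (length $|\alpha|=k$); $\mathfrak p$ is the set of finite paths, including vertices, and $\mathfrak p^\infty$ the set of infinite paths $\gamma_1\gamma_2\ldots$ (with $r(\gamma_i)=s(\gamma_{i+1})$). One sets $r(v)=s(v)=v$ for vertices, $r(\alpha)=r(\alpha_{|\alpha|})$, $s(\alpha)=s(\alpha_1)$, $s(\gamma)\gamma=\gamma$, and $\gamma r(\gamma)=\gamma$ for finite $\gamma$. A finite path $\gamma$ is an initial segment of a path $\beta$ if $\beta=\gamma\gamma'$ for some path $\gamma'$ (so $s(\beta)$ is an initial segment of $\beta$). A vertex $v$ is an infinite emitter if $s^{-1}(v)$ is infinite. The associated system. $X=\mathfrak p^\infty\cup X_{fin}$, where $X_{fin}=\{\alpha\in\mathfrak p: r(\alpha)\text{ is an infinite emitter}\}$. The map $\sigma$ has domain $\mathrm{Dom}(\sigma)=\{x\in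 X:|x|\ge1\}$ and deletes the first edge: $\sigma(\gamma_1\gamma_2\ldots)=\gamma_2\gamma_3\ldots$, $\sigma(\gamma_1\ldots\gamma_n)=\gamma_2\ldots\gamma_n$ for $n\ge2$, $\sigma(\gamma_1)=r(\gamma_1)$. Metric. With $E^1=\{e_1,e_2,\ldots\}$, fix an edge ordered enumeration $\mathfrak p=\{p_1,p_2,\ldots\}$, i.e. one such that for every $e_i$ the source of $e_i$ and all paths of length less than $i$ formed by edges $e_k$ with $k<i$ appear before $e_i$. For $x\ne y$ in $X$, $d(x,y)=1/2^i$ where $i$ is the smallest value such that $p_i$ is an initial segment of one of $x,y$ but not of the other; $d(x,x)=0$. Shadowing. A (finite) $\delta$-chain is an infinite sequence $(x_i)_{i=1}^\infty$ (respectively a finite sequence $(x_i)_{i=1}^k$) in $X$ such that $x_i\in\mathrm{Dom}(\sigma)$ and $d(\sigma(x_i),x_{i+1})<\delta$ for all $i$ (respectively for all $1\le i<k$; the last term need not be in $\mathrm{Dom}(\sigma)$). A point $x\in X$ $\varepsilon$-shadows a finite or infinite sequence $(y_i)_{i\ge1}$ if, for all indices $i$, $\sigma^{i-1}(x)$ is defined and $d(\sigma^{i-1}(x),y_i)<\varepsilon$. The system has the (finite) shadowing property if for every $\varepsilon>0$ there is $\delta>0$ such that every infinite (respectively every finite) $\delta$-chain is $\varepsilon$-shadowed by some $x\in X$. *)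

theory Defs
  imports Complex_Main "HOL-Library.Stream" "HOL-Library.Extended_Nat"
    "HOL-Library.Countable_Set" "Graph_Theory.Digraph"
begin

section \<open>Graphs and paths\<close>

text \<open>
  The source map s is \<^const>\<open>tail\<close> and the range map r is \<^const>\<open>head\<close>.
\<close>

locale countable_digraph = wf_digraph +
  assumes countable_verts: "countable (verts G)"
    and countable_arcs: "countable (arcs G)"

text \<open>
  Raw paths: a vertex (length 0), a list of edges (length at least 1), or a stream of edges.
  The term \<open>Fin []\<close> is not a path.
\<close>

datatype ('v, 'e) gpath = Vtx 'v | Fin "'e list" | Inf "'e stream"

definition finite_paths :: "('v, 'e) pre_digraph \<Rightarrow> ('v, 'e) gpath set" where
  "finite_paths G = Vtx ` verts G \<union>
     {Fin as | as. as \<noteq> [] \<and> set as \<subseteq> arcs G \<and>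
        (\<forall>i. Suc i < length as \<longrightarrow> head G (as ! i) = tail G (as ! Suc i))}"

definition infinite_paths :: "('v, 'e) pre_digraph \<Rightarrow> ('v, 'e) gpath set" where
  "infinite_paths G =
     {Inf w | w. sset w \<subseteq> arcs G \<and> (\<forall>i. head G (w !! i) = tail G (w !! Suc i))}"

fun path_length :: "('v, 'e) gpath \<Rightarrow> enat" where
  "path_length (Vtx v) = 0"
| "path_length (Fin as) = enat (length as)"
| "path_length (Inf w) = \<infinity>"

fun path_source :: "('v, 'e) pre_digraph \<Rightarrow> ('v, 'e) gpath \<Rightarrow> 'v" where
  "path_source G (Vtx v) = v"
| "path_source G (Fin as) = tail G (hd as)"
| "path_source G (Inf w) = tail G (shd w)"

text \<open>The range of a path, and the path in front in a concatenation, are only meant for finite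
  paths; the values on \<open>Inf w\<close> are irrelevant.\<close>

fun path_range :: "('v, 'e) pre_digraph \<Rightarrow> ('v, 'e) gpath \<Rightarrow> 'v" where
  "path_range G (Vtx v) = v"
| "path_range G (Fin as) = head G (last as)"
| "path_range G (Inf w) = undefined"

fun path_concat :: "('v, 'e) gpath \<Rightarrow> ('v, 'e) gpath \<Rightarrow> ('v, 'e) gpath" where
  "path_concat (Vtx v) b = b"
| "path_concat (Fin as) (Vtx v) = Fin as"
| "path_concat (Fin as) (Fin bs) = Fin (as @ bs)"
| "path_concat (Fin as) (Inf w) = Inf (as @- w)"
| "path_concat (Inf w) b = undefined"

definition initial_segment ::
    "('v, 'e) pre_digraph \<Rightarrow> ('v, 'e) gpath \<Rightarrow> ('v, 'e) gpath \<Rightarrow> bool" where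
  "initial_segment G c b \<longleftrightarrow> c \<in> finite_paths G \<and>
     (\<exists>c' \<in> finite_paths G \<union> infinite_paths G.
        path_range G c = path_source G c' \<and> b = path_concat c c')"

definition infinite_emitter :: "('v, 'e) pre_digraph \<Rightarrow> 'v \<Rightarrow> bool" where
  "infinite_emitter G v \<longleftrightarrow> v \<in> verts G \<and> infinite {a \<in> arcs G. tail G a = v}"

section \<open>The Deaconu-Renault system of a graph\<close>

definition DR_space :: "('v, 'e) pre_digraph \<Rightarrow> ('v, 'e) gpath set" where
  "DR_space G = infinite_paths G \<union>
     {c \<in> finite_paths G. infinite_emitter G (path_range G c)}"

definition DR_dom :: "('v, 'e) pre_digraph \<Rightarrow> ('v, 'e) gpath set" where
  "DR_dom G = {x \<in> DR_space G. path_length x \<ge> 1}"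

text \<open>The value on a vertex, which is outside the domain, is irrelevant.\<close>

fun DR_shift :: "('v, 'e) pre_digraph \<Rightarrow> ('v, 'e) gpath \<Rightarrow> ('v, 'e) gpath" where
  "DR_shift G (Vtx v) = Vtx v"
| "DR_shift G (Fin as) = (if length as \<ge> 2 then Fin (tl as) else Vtx (head G (hd as)))"
| "DR_shift G (Inf w) = Inf (stl w)"

text \<open>
  Enumerations are indexed from 1. The definition is for graphs with infinitely many edges, so that
  both index sets are all of \<open>{1..}\<close>. The paths formed by edges \<open>e k\<close> with \<open>k < i\<close> have length at
  least 1; vertices are not counted among them (otherwise, in a graph with infinitely many
  vertices, no enumeration would have the property).
\<close>

definition edge_ordered_enumeration ::
    "('v, 'e) pre_digraph \<Rightarrow> (nat \<Rightarrow> 'e) \<Rightarrow> (nat \<Rightarrow> ('v, 'e) gpath) \<Rightarrow> bool" where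
  "edge_ordered_enumeration G e p \<longleftrightarrow>
     bij_betw e {1..} (arcs G) \<and> bij_betw p {1..} (finite_paths G) \<and>
     (\<forall>i\<ge>1. \<forall>j\<ge>1. p j = Fin [e i] \<longrightarrow>
        Vtx (tail G (e i)) \<in> p ` {1..<j} \<and>
        (\<forall>as. Fin as \<in> finite_paths G \<and> length as < i \<and> set as \<subseteq> e ` {1..<i}
           \<longrightarrow> Fin as \<in> p ` {1..<j}))"

definition DR_dist ::
    "('v, 'e) pre_digraph \<Rightarrow> (nat \<Rightarrow> ('v, 'e) gpath) \<Rightarrow> ('v, 'e) gpath \<Rightarrow> ('v, 'e) gpath \<Rightarrow> real" where
  "DR_dist G p x y =
     (if x = y then 0
      else 1 / 2 ^ (LEAST i. i \<ge> 1 \<and> initial_segment G (p i) x \<noteq> initial_segment G (p i) y))"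

section \<open>Shadowing\<close>

text \<open>Terms of sequences are indexed from 0 here, so the shadowing condition at index \<open>i\<close> involves
  the \<open>i\<close>-th iterate of the shift.\<close>

definition delta_chain ::
    "('v, 'e) pre_digraph \<Rightarrow> (nat \<Rightarrow> ('v, 'e) gpath) \<Rightarrow> real \<Rightarrow> (nat \<Rightarrow> ('v, 'e) gpath) \<Rightarrow> bool" where
  "delta_chain G p \<delta> x \<longleftrightarrow>
     (\<forall>i. x i \<in> DR_dom G \<and> DR_dist G p (DR_shift G (x i)) (x (Suc i)) < \<delta>)"

definition finite_delta_chain ::
    "('v, 'e) pre_digraph \<Rightarrow> (nat \<Rightarrow> ('v, 'e) gpath) \<Rightarrow> real \<Rightarrow> ('v, 'e) gpath list \<Rightarrow> bool" where
  "finite_delta_chain G p \<delta> xs \<longleftrightarrow> xs \<noteq> [] \<and> set xs \<subseteq> DR_space G \<and>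
     (\<forall>i. Suc i < length xs \<longrightarrow>
        xs ! i \<in> DR_dom G \<and> DR_dist G p (DR_shift G (xs ! i)) (xs ! Suc i) < \<delta>)"

definition iterate_defined :: "('v, 'e) pre_digraph \<Rightarrow> nat \<Rightarrow> ('v, 'e) gpath \<Rightarrow> bool" where
  "iterate_defined G n x \<longleftrightarrow> x \<in> DR_space G \<and> (\<forall>m<n. (DR_shift G ^^ m) x \<in> DR_dom G)"

definition shadows ::
    "('v, 'e) pre_digraph \<Rightarrow> (nat \<Rightarrow> ('v, 'e) gpath) \<Rightarrow> real \<Rightarrow> ('v, 'e) gpath \<Rightarrow>
     (nat \<Rightarrow> ('v, 'e) gpath) \<Rightarrow> bool" where
  "shadows G p \<epsilon> x y \<longleftrightarrow>
     (\<forall>i. iterate_defined G i x \<and> DR_dist G p ((DR_shift G ^^ i) x) (y i) < \<epsilon>)"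

definition finite_shadows ::
    "('v, 'e) pre_digraph \<Rightarrow> (nat \<Rightarrow> ('v, 'e) gpath) \<Rightarrow> real \<Rightarrow> ('v, 'e) gpath \<Rightarrow>
     ('v, 'e) gpath list \<Rightarrow> bool" where
  "finite_shadows G p \<epsilon> x ys \<longleftrightarrow>
     (\<forall>i<length ys. iterate_defined G i x \<and> DR_dist G p ((DR_shift G ^^ i) x) (ys ! i) < \<epsilon>)"

definition shadowing_property ::
    "('v, 'e) pre_digraph \<Rightarrow> (nat \<Rightarrow> ('v, 'e) gpath) \<Rightarrow> bool" where
  "shadowing_property G p \<longleftrightarrow>
     (\<forall>\<epsilon>>0. \<exists>\<delta>>0. \<forall>y. delta_chain G p \<delta> y \<longrightarrow> (\<exists>x\<in>DR_space G. shadows G p \<epsilon> x y))"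

definition finite_shadowing_property ::
    "('v, 'e) pre_digraph \<Rightarrow> (nat \<Rightarrow> ('v, 'e) gpath) \<Rightarrow> bool" where
  "finite_shadowing_property G p \<longleftrightarrow>
     (\<forall>\<epsilon>>0. \<exists>\<delta>>0. \<forall>ys. finite_delta_chain G p \<delta> ys \<longrightarrow>
        (\<exists>x\<in>DR_space G. finite_shadows G p \<epsilon> x ys))"

section \<open>The graph of the example\<close>

text \<open>The vertex \<open>v\<^sub>k\<close> and the edge \<open>e\<^sub>k\<close> are both represented by the number \<open>k\<close>, for \<open>k \<ge> 1\<close>:
  \<open>e\<^sub>1\<close> is a loop at \<open>v\<^sub>1\<close>, and \<open>e\<^sub>k\<close> goes from \<open>v\<^sub>k\<close> to \<open>v\<^sub>k\<^sub>-\<^sub>1\<close> for \<open>k \<ge> 2\<close>.\<close>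

definition E_f :: "(nat, nat) pre_digraph" where
  "E_f = \<lparr> verts = {1..}, arcs = {1..}, tail = (\<lambda>k. k), head = (\<lambda>k. if k = 1 then 1 else k - 1) \<rparr>"

lemma E_f_ends:
  "tail E_f 1 = 1" "head E_f 1 = 1" "head E_f 2 = 1"
  "k \<ge> 2 \<Longrightarrow> tail E_f k = k" "k \<ge> 2 \<Longrightarrow> head E_f (k + 1) = k"
  by (auto simp: E_f_def)

lemma countable_digraph_E_f: "countable_digraph E_f"
  by unfold_locales (auto simp: E_f_def)

end

theory Submission
  imports Defs
begin

text \<open>
  Every vertex of \<open>E_f\<close> emits exactly one edge, so there are no infinite emitters and \<open>X\<close> consists of
  one infinite path \<open>x\<^sub>k\<close> for each vertex \<open>v\<^sub>k\<close>; the shift maps \<open>x\<^sub>k\<close> to \<open>x\<^sub>k\<^sub>-\<^sub>1\<close> and fixes \<open>x\<^sub>1\<close>. The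
  initial segments of \<open>x\<^sub>k\<close> are precisely the finite paths with source \<open>v\<^sub>k\<close>, so two distinct points
  are close exactly when both indices are large. Since every point has a preimage, a
  finite chain is shadowed by pulling back from its last term, the only errors being made among
  points of large index. However, \<open>x\<^sub>K, x\<^sub>K\<^sub>+\<^sub>1, x\<^sub>K\<^sub>+\<^sub>2, \<dots>\<close> is an infinite \<open>\<delta>\<close>-chain for large \<open>K\<close>, whereas
  every orbit ends in \<open>x\<^sub>1\<close>, which is isolated.
\<close>

section \<open>Points of the space and iterates of \<open>head E_f\<close>\<close>

text \<open>Edge \<open>k\<close> is the only edge with source \<open>k\<close>, so in any path it
  can only be followed by edge \<open>head E_f k\<close>.\<close>

abbreviation ray :: "nat \<Rightarrow> (nat, nat) gpath" where
  "ray k \<equiv> Inf (siterate (head E_f) k)"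

lemma head_E_f: "head E_f k = (if k = 1 then 1 else k - 1)"
  by (simp add: E_f_def)

lemma tail_E_f [simp]: "tail E_f k = k"
  by (simp add: E_f_def)

lemma arcs_E_f: "arcs E_f = {1..}"
  by (simp add: E_f_def)

lemma head_E_f_pow_ge_1: "k \<ge> 1 \<Longrightarrow> (head E_f ^^ n) k \<ge> 1"
  by (induction n) (auto simp: head_E_f)

text \<open>The vertex 1 is reached after \<open>k - 1\<close> steps already and is then fixed; the
  exponent \<open>k\<close> avoids the subtraction.\<close>

lemma head_E_f_pow_eq_1: "k \<ge> 1 \<Longrightarrow> (head E_f ^^ k) k = 1"
proof (induction k)
  case (Suc k)
  then show ?case
    by (cases "k = 0") (auto simp: head_E_f funpow_Suc_right simp del: funpow.simps)
qed simp

lemma siterate_eq_iff [simp]: "siterate f j = siterate f k \<longleftrightarrow> j = k"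
  by (metis siterate.simps(1))

lemma DR_shift_ray_pow: "(DR_shift E_f ^^ n) (ray k) = ray ((head E_f ^^ n) k)"
  by (induction n) auto

lemma ray_in_infinite_paths:
  assumes "k \<ge> 1"
  shows "ray k \<in> infinite_paths E_f"
  using head_E_f_pow_ge_1[OF assms]
  by (auto simp: infinite_paths_def sset_siterate arcs_E_f funpow_swap1)

lemma infinite_paths_E_f: "infinite_paths E_f = ray ` {1..}"
proof (intro equalityI subsetI)
  fix x assume "x \<in> infinite_paths E_f"
  then obtain w where x: "x = Inf w" and arcs: "sset w \<subseteq> arcs E_f"
    and step: "\<And>i. head E_f (w !! i) = w !! Suc i"
    by (auto simp: infinite_paths_def simp del: snth.simps)
  have "w !! n = siterate (head E_f) (shd w) !! n" for n
    by (induction n) (auto simp: step[symmetric] simp del: snth.simps(2))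
  then have "w = siterate (head E_f) (shd w)"
    by (metis ext stream_smap_nats)
  moreover have "shd w \<ge> 1"
    using arcs shd_sset[of w] by (auto simp: E_f_def)
  ultimately show "x \<in> ray ` {1..}"
    using x by auto
qed (use ray_in_infinite_paths in auto)

lemma DR_space_E_f: "DR_space E_f = ray ` {1..}"
proof -
  have "\<not> infinite_emitter E_f v" for v
    using finite_subset[of "{a \<in> arcs E_f. tail E_f a = v}" "{v}"]
    by (auto simp: infinite_emitter_def)
  then show ?thesis
    by (simp add: DR_space_def infinite_paths_E_f)
qed

lemma DR_dom_E_f: "DR_dom E_f = ray ` {1..}"
  by (auto simp: DR_dom_def DR_space_E_f)

lemma iterate_defined_ray: "k \<ge> 1 \<Longrightarrow> iterate_defined E_f n (ray k)"
  using head_E_f_pow_ge_1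
  by (auto simp: iterate_defined_def DR_space_E_f DR_dom_E_f DR_shift_ray_pow)

section \<open>Initial segments\<close>

lemma Fin_path_E_f_nth:
  assumes "Fin as \<in> finite_paths E_f" "i < length as"
  shows "as ! i = (head E_f ^^ i) (hd as)"
  using assms(2)
proof (induction i)
  case (Suc i)
  with assms(1) have "head E_f (as ! i) = as ! Suc i"
    by (auto simp: finite_paths_def)
  with Suc show ?case by simp
qed (simp add: hd_conv_nth)

text \<open>A finite path is determined by its source and its length, so each one that starts at
  \<open>k\<close> is a truncation of \<open>ray k\<close>.\<close>

lemma initial_segment_ray_iff:
  assumes "k \<ge> 1"
  shows "initial_segment E_f c (ray k) \<longleftrightarrow> c \<in> finite_paths E_f \<and> path_source E_f c = k"
proof (cases c)
  case (Vtx v)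
  then show ?thesis
    using ray_in_infinite_paths[OF assms] by (auto simp: initial_segment_def)
next
  case (Inf w)
  then show ?thesis
    by (auto simp: initial_segment_def finite_paths_def)
next
  case (Fin as)
  show ?thesis
  proof
    assume seg: "initial_segment E_f c (ray k)"
    then obtain c' where path: "Fin as \<in> finite_paths E_f"
      and concat: "ray k = path_concat (Fin as) c'"
      unfolding initial_segment_def Fin by blast
    from concat obtain w where "siterate (head E_f) k = as @- w"
      by (cases c') auto
    then have "k = shd (as @- w)"
      by (metis siterate.simps(1))
    moreover have "as \<noteq> []"
      using path by (auto simp: finite_paths_def)
    ultimately show "c \<in> finite_paths E_f \<and> path_source E_f c = k"
      using path by (simp add: Fin)
  next
    assume "c \<in> finite_paths E_f \<and> path_source E_f c = k"
    then have path: "Fin as \<in> finite_paths E_f" and hd: "hd as = k"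
      by (auto simp: Fin)
    have ne: "as \<noteq> []"
      using path by (auto simp: finite_paths_def)
    define n where "n = length as"
    have "as = stake n (siterate (head E_f) k)"
      using Fin_path_E_f_nth[OF path] hd by (intro nth_equalityI) (auto simp: n_def)
    then have "ray k = path_concat c (ray ((head E_f ^^ n) k))"
      by (metis Fin path_concat.simps(4) sdrop_siterate stake_sdrop)
    moreover have "path_range E_f c = (head E_f ^^ n) k"
    proof -
      \<comment> \<open>The range is the head of the last edge, which has index
        \<open>n - 1\<close>.\<close>
      have "n = Suc (n - 1)"
        using ne by (simp add: n_def)
      moreover have "last as = (head E_f ^^ (n - 1)) k"
        using Fin_path_E_f_nth[OF path, of "n - 1"] ne hd by (simp add: last_conv_nth n_def)
      ultimately show ?thesis
        by (metis Fin path_range.simps(2) funpow.simps(2) comp_apply)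
    qed
    ultimately show "initial_segment E_f c (ray k)"
      using path ray_in_infinite_paths[OF head_E_f_pow_ge_1[OF assms, of n]]
      unfolding initial_segment_def Fin
      by (intro conjI bexI[of _ "ray ((head E_f ^^ n) k)"]) auto
  qed
qed

section \<open>The metric on rays\<close>

context
  fixes p :: "nat \<Rightarrow> (nat, nat) gpath"
  assumes p: "bij_betw p {1..} (finite_paths E_f)"
begin

text \<open>No path starts at both \<open>j\<close> and \<open>k\<close>, so a path separates the
  two rays as soon as it starts at either.\<close>

lemma DR_dist_ray:
  assumes "j \<ge> 1" "k \<ge> 1" "j \<noteq> k"
  shows "DR_dist E_f p (ray j) (ray k) =
    1 / 2 ^ (LEAST i. i \<ge> 1 \<and> (path_source E_f (p i) = j \<or> path_source E_f (p i) = k))"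
proof -
  have "p i \<in> finite_paths E_f" if "i \<ge> 1" for i
    using that bij_betwE[OF p] by auto
  then have "(i \<ge> 1 \<and> initial_segment E_f (p i) (ray j) \<noteq> initial_segment E_f (p i) (ray k)) \<longleftrightarrow>
    (i \<ge> 1 \<and> (path_source E_f (p i) = j \<or> path_source E_f (p i) = k))" for i
    using assms by (auto simp: initial_segment_ray_iff)
  then show ?thesis
    using assms by (simp add: DR_dist_def)
qed

lemma ex_path_source:
  assumes "k \<ge> 1"
  shows "\<exists>i\<ge>1. path_source E_f (p i) = k"
proof -
  have "Vtx k \<in> p ` {1..}"
    using assms bij_betw_imp_surj_on[OF p] by (auto simp: finite_paths_def E_f_def)
  then obtain i where "i \<ge> 1" "p i = Vtx k"
    by auto
  then show ?thesis
    by (intro exI[of _ i]) simp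
qed

lemma DR_dist_ray_ge:
  assumes "i \<ge> 1" "path_source E_f (p i) = j" "j \<ge> 1" "k \<ge> 1" "j \<noteq> k"
  shows "1 / 2 ^ i \<le> DR_dist E_f p (ray j) (ray k)"
    and "1 / 2 ^ i \<le> DR_dist E_f p (ray k) (ray j)"
proof -
  \<comment> \<open>The two orders of the arguments give different predicates under
    \<open>LEAST\<close>, hence the general \<open>Q\<close>.\<close>
  have least: "(1::real) / 2 ^ i \<le> 1 / 2 ^ (LEAST i. i \<ge> 1 \<and> Q i)" if "Q i" for Q
    using assms(1) that by (intro divide_left_mono power_increasing Least_le) auto
  show "1 / 2 ^ i \<le> DR_dist E_f p (ray j) (ray k)"
    unfolding DR_dist_ray[OF assms(3-5)] using assms(2) by (intro least) simp
  show "1 / 2 ^ i \<le> DR_dist E_f p (ray k) (ray j)"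
    unfolding DR_dist_ray[OF assms(4,3) assms(5)[symmetric]] using assms(2) by (intro least) simp
qed

text \<open>The first \<open>N\<close> paths have only finitely many sources; none of these paths
  separates two rays that start beyond all those sources.\<close>

lemma ray_close_if_large:
  assumes "\<epsilon> > 0"
  obtains M where "M \<ge> 1" "\<And>j k. j > M \<Longrightarrow> k > M \<Longrightarrow> DR_dist E_f p (ray j) (ray k) < \<epsilon>"
proof -
  obtain N where N: "(1 / 2) ^ N < \<epsilon>"
    using real_arch_pow_inv[OF assms, of "1 / 2"] by auto
  \<comment> \<open>Inserting 1 ensures \<open>M \<ge> 1\<close>. The value \<open>p 0\<close> lies
    outside the enumeration and can only enlarge \<open>M\<close>.\<close>
  define M where "M = Max (insert 1 ((\<lambda>i. path_source E_f (p i)) ` {..N}))"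
  have source: "path_source E_f (p i) \<le> M" if "i \<le> N" for i
    unfolding M_def using that by (intro Max_ge) auto
  have M: "M \<ge> 1"
    unfolding M_def by (intro Max_ge) auto
  have "DR_dist E_f p (ray j) (ray k) < \<epsilon>" if large: "j > M" "k > M" for j k
  proof (cases "j = k")
    case True
    then show ?thesis using assms by (simp add: DR_dist_def)
  next
    case False
    define P where "P i \<longleftrightarrow> i \<ge> 1 \<and> (path_source E_f (p i) = j \<or> path_source E_f (p i) = k)" for i
    obtain i where "P i"
      using ex_path_source[of j] large M unfolding P_def by auto
    then have "P (LEAST i. P i)"
      by (rule LeastI)
    then have "\<not> (LEAST i. P i) \<le> N"
      using source large by (metis P_def not_less)
    then have "(1::real) / 2 ^ (LEAST i. P i) \<le> (1 / 2) ^ N"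
      by (auto simp: power_one_over intro!: divide_left_mono power_increasing)
    then show ?thesis
      using N large M False by (simp add: DR_dist_ray P_def)
  qed
  with M show ?thesis by (rule that)
qed

text \<open>Each of the finitely many points with index up to \<open>M\<close> is isolated, so one
  \<delta> keeps them all away from every other point.\<close>

lemma eq_or_large_if_ray_close:
  obtains \<delta> :: real where "\<delta> > 0"
    "\<And>j k. \<lbrakk>j \<ge> 1; k \<ge> 1; DR_dist E_f p (ray j) (ray k) < \<delta>\<rbrakk> \<Longrightarrow> j = k \<or> (j > M \<and> k > M)"
proof -
  obtain f where f: "\<And>k. k \<ge> 1 \<Longrightarrow> f k \<ge> 1 \<and> path_source E_f (p (f k)) = k"
    using ex_path_source by metis
  define N where "N = Max (f ` {..M})"
  have less: "(1::real) / 2 ^ N \<le> 1 / 2 ^ f k" if "k \<le> M" for k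
    unfolding N_def using that by (intro divide_left_mono power_increasing Max_ge) auto
  show ?thesis
  proof
    show "(0::real) < 1 / 2 ^ N" by simp
  next
    fix j k assume jk: "j \<ge> 1" "k \<ge> 1" "DR_dist E_f p (ray j) (ray k) < 1 / 2 ^ N"
    have "j > M \<and> k > M" if "j \<noteq> k"
    proof -
      have "1 / 2 ^ f j < (1::real) / 2 ^ N"
        using f[OF jk(1)] jk that by (intro le_less_trans[OF DR_dist_ray_ge(1) jk(3)]) auto
      moreover have "1 / 2 ^ f k < (1::real) / 2 ^ N"
        using f[OF jk(2)] jk that by (intro le_less_trans[OF DR_dist_ray_ge(2) jk(3)]) auto
      ultimately show ?thesis
        using less[of j] less[of k] by (meson not_less)
    qed
    then show "j = k \<or> (j > M \<and> k > M)"
      by blast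
  qed
qed

section \<open>Finite shadowing\<close>

text \<open>A point that follows the tail of the list is replaced by a preimage. Errors do not
  accumulate: being equal or both above \<open>M\<close> is a transitive relation, and it lifts to
  suitable preimages.\<close>

lemma finite_pseudo_orbit_shadowed:
  assumes "M \<ge> 1" and "ks \<noteq> []" and "set ks \<subseteq> {1..}"
    and "\<And>i. Suc i < length ks \<Longrightarrow>
      head E_f (ks ! i) = ks ! Suc i \<or> (head E_f (ks ! i) > M \<and> ks ! Suc i > M)"
  shows "\<exists>j\<ge>1. \<forall>i<length ks.
    (head E_f ^^ i) j = ks ! i \<or> ((head E_f ^^ i) j > M \<and> ks ! i > M)"
  using assms(2-)
proof (induction ks)
  case (Cons k ks)
  show ?case
  proof (cases "ks = []")
    case True
    then show ?thesis using Cons.prems by auto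
  next
    case False
    have "\<exists>j\<ge>1. \<forall>i<length ks.
      (head E_f ^^ i) j = ks ! i \<or> ((head E_f ^^ i) j > M \<and> ks ! i > M)"
      using Cons.prems(2) Cons.prems(3)[of "Suc _"] False by (intro Cons.IH) auto
    then obtain j where j: "j \<ge> 1" "\<And>i. i < length ks \<Longrightarrow>
      (head E_f ^^ i) j = ks ! i \<or> ((head E_f ^^ i) j > M \<and> ks ! i > M)"
      by auto
    have "head E_f k = j \<or> (head E_f k > M \<and> j > M)"
      using j(2)[of 0] Cons.prems(3)[of 0] False by auto
    then obtain j' where j': "j' \<ge> 1" "head E_f j' = j" "j' = k \<or> (j' > M \<and> k > M)"
    \<comment> \<open>The vertex 1 has the two preimages 1 and 2. If \<open>k = 1\<close>, then
      \<open>M \<ge> 1\<close> forces \<open>j = 1\<close> and the loop is the right choice;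
      otherwise \<open>Suc j\<close> is.\<close>
    proof (cases "k = 1")
      case True
      with \<open>head E_f k = j \<or> _\<close> assms(1) that[of 1] show thesis
        by (auto simp: head_E_f)
    next
      case False
      with \<open>head E_f k = j \<or> _\<close> j(1) Cons.prems(2) have "Suc j = k \<or> (Suc j > M \<and> k > M)"
        by (auto simp: head_E_f)
      with j(1) that[of "Suc j"] show thesis
        by (simp add: head_E_f)
    qed
    have "(head E_f ^^ i) j' = (k # ks) ! i \<or> ((head E_f ^^ i) j' > M \<and> (k # ks) ! i > M)"
      if "i < length (k # ks)" for i
    proof (cases i)
      case (Suc n)
      then show ?thesis
        using j(2)[of n] j'(2) that by (simp add: funpow_Suc_right del: funpow.simps)
    qed (use j'(3) in simp)
    with j'(1) show ?thesis by blast
  qed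
qed simp

lemma finite_shadowing_E_f: "finite_shadowing_property E_f p"
  unfolding finite_shadowing_property_def
proof (intro allI impI)
  fix \<epsilon> :: real assume \<epsilon>: "\<epsilon> > 0"
  then obtain M where M: "M \<ge> 1"
    "\<And>j k. j > M \<Longrightarrow> k > M \<Longrightarrow> DR_dist E_f p (ray j) (ray k) < \<epsilon>"
    using ray_close_if_large by blast
  \<comment> \<open>The threshold \<open>M\<close> found for \<epsilon> now determines \<delta>:
    jumps of the chain occur only above \<open>M\<close>, where distances are below
    \<epsilon>.\<close>
  obtain \<delta> :: real where \<delta>: "\<delta> > 0"
    "\<And>j k. \<lbrakk>j \<ge> 1; k \<ge> 1; DR_dist E_f p (ray j) (ray k) < \<delta>\<rbrakk> \<Longrightarrow> j = k \<or> (j > M \<and> k > M)"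
    using eq_or_large_if_ray_close by blast
  have "\<exists>x\<in>DR_space E_f. finite_shadows E_f p \<epsilon> x ys" if chain: "finite_delta_chain E_f p \<delta> ys" for ys
  proof -
    have "ys \<in> lists (ray ` {1..})"
      using chain by (auto simp: finite_delta_chain_def DR_space_E_f)
    then obtain ks where ks: "set ks \<subseteq> {1..}" and ys: "ys = map ray ks"
      by (auto simp: lists_image)
    have pos: "ks ! i \<ge> 1" if "i < length ks" for i
      using ks nth_mem[OF that] by auto
    have "\<exists>j\<ge>1. \<forall>i<length ks.
      (head E_f ^^ i) j = ks ! i \<or> ((head E_f ^^ i) j > M \<and> ks ! i > M)"
    proof (rule finite_pseudo_orbit_shadowed[OF M(1) _ ks])
      show "ks \<noteq> []"
        using chain by (auto simp: ys finite_delta_chain_def)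
    next
      fix i assume i: "Suc i < length ks"
      then have "DR_dist E_f p (ray (head E_f (ks ! i))) (ray (ks ! Suc i)) < \<delta>"
        using chain by (auto simp: ys finite_delta_chain_def)
      then show "head E_f (ks ! i) = ks ! Suc i \<or> (head E_f (ks ! i) > M \<and> ks ! Suc i > M)"
        using head_E_f_pow_ge_1[of "ks ! i" 1] pos[of i] pos[of "Suc i"] i by (intro \<delta>(2)) auto
    qed
    then obtain j where j: "j \<ge> 1" "\<And>i. i < length ks \<Longrightarrow>
      (head E_f ^^ i) j = ks ! i \<or> ((head E_f ^^ i) j > M \<and> ks ! i > M)"
      by blast
    have "DR_dist E_f p (ray ((head E_f ^^ i) j)) (ray (ks ! i)) < \<epsilon>" if "i < length ks" for i
      using j(2)[OF that] M(2) \<epsilon> by (auto simp: DR_dist_def[of _ _ x x for x])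
    then have "finite_shadows E_f p \<epsilon> (ray j) ys"
      using j(1) by (simp add: finite_shadows_def ys iterate_defined_ray DR_shift_ray_pow)
    then show ?thesis
      using j(1) by (auto simp: DR_space_E_f)
  qed
  with \<delta>(1) show "\<exists>\<delta>>0. \<forall>ys. finite_delta_chain E_f p \<delta> ys \<longrightarrow>
      (\<exists>x\<in>DR_space E_f. finite_shadows E_f p \<epsilon> x ys)"
    by blast
qed

section \<open>Failure of infinite shadowing\<close>

lemma not_shadowing_E_f: "\<not> shadowing_property E_f p"
proof
  assume "shadowing_property E_f p"
  \<comment> \<open>With such an \<open>i\<close>, every other point has distance at least
    \<open>1 / 2 ^ i\<close> from \<open>ray 1\<close>.\<close>
  obtain i where i: "i \<ge> 1" "path_source E_f (p i) = 1"
    using ex_path_source[of 1] by auto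
  have "(1::real) / 2 ^ i > 0" by simp
  with \<open>shadowing_property E_f p\<close> obtain \<delta> :: real where "\<delta> > 0"
    and shadow: "\<And>y. delta_chain E_f p \<delta> y \<Longrightarrow> \<exists>x\<in>DR_space E_f. shadows E_f p (1 / 2 ^ i) x y"
    unfolding shadowing_property_def by blast
  then obtain M where M: "M \<ge> 1"
    "\<And>j k. j > M \<Longrightarrow> k > M \<Longrightarrow> DR_dist E_f p (ray j) (ray k) < \<delta>"
    using ray_close_if_large by blast
  \<comment> \<open>The offset 2 keeps the shifted point, of index \<open>M + 1 + n\<close>, above
    \<open>M\<close> even for \<open>n = 0\<close>.\<close>
  define y where "y n = ray (M + 2 + n)" for n
  have "delta_chain E_f p \<delta> y"
    using M by (auto simp: delta_chain_def y_def DR_dom_E_f head_E_f)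
  then obtain j where j: "j \<ge> 1" "shadows E_f p (1 / 2 ^ i) (ray j) y"
    using shadow by (auto simp: DR_space_E_f)
  \<comment> \<open>At time \<open>j\<close> the orbit of \<open>ray j\<close> has arrived at
    \<open>ray 1\<close>, while the chain has moved away.\<close>
  then have "DR_dist E_f p ((DR_shift E_f ^^ j) (ray j)) (y j) < 1 / 2 ^ i"
    by (simp add: shadows_def)
  then have "DR_dist E_f p (ray 1) (ray (M + 2 + j)) < 1 / 2 ^ i"
    using j(1) by (simp add: DR_shift_ray_pow head_E_f_pow_eq_1 y_def)
  with DR_dist_ray_ge(1)[OF i, of "M + 2 + j"] show False
    by simp
qed

end

theorem proposition5p14:
  fixes e :: "nat \<Rightarrow> nat" and p :: "nat \<Rightarrow> (nat, nat) gpath"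
  assumes "edge_ordered_enumeration E_f e p"
  shows "finite_shadowing_property E_f p \<and> \<not> shadowing_property E_f p"
  using assms finite_shadowing_E_f not_shadowing_E_f
  by (simp add: edge_ordered_enumeration_def)

end
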